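(* Fix a finite learning state and its approximate outputs as in the context, giving approximate probabilities $\pi_1,\dots,\pi_C$, endpoint gaps $g_j=|r_j-k_j|\ge0$, a target class $y$ and a temperature $\tau>0$. Let $B_L(s,b)$, $B_P(s,b)$, $B_g(s,b)$ be the certificate functions of the scalar allowance $b\ge0$ defined in the context (with $\pi$, $g$, $y$, $\tau$ kept fixed as $b$ varies). Then each of $B_L(s,\cdot)$, $B_P(s,\cdot)$, $B_g(s,\cdot)$ is continuous and nondecreasing on $[0,\infty)$ and vanishes at $b=0$. Moreover, for every selected set of quantities $\mathcal G\subseteq\{L,P,g\}$ and every choice of positive budgets $(\epsilon_G)_{G\in\mathcal G}$, the simultaneously accepted set $$\{b\ge0:\ B_G(s,b)\le\epsilon_G\ \text{for all }G\in\mathcal G\}$$ is an interval starting at (and containing) $0$. Consequently, whenever its supremum $b_\star(s;\boldsymbol\epsilon)$ is finite, it can be found by bracketed scalar inversion (bisection on the acceptance condition), using only $\pi,g,y,\tau,\boldsymbol\epsilon$ and not the exact scores, probabilities, losses or gradients.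
   Context: State. $p\ge5$ is an integer, $C\ge2$ the number of classes, $\mu_1,\dots,\mu_C\in\mathbb R^p$ unit vectors, $k_j\ge0$, $c_j\in\mathbb R$, $\tau>0$, $f\in\mathbb R^p$, $y\in\{1,\dots,C\}$; $r_j=\lVert k_j\mu_j+f/\tau\rVert$. A paired realization $(F,A)$ consists of real functions on $[0,\infty)$ with $F$ differentiable, $F'=A$, $A(0)=0$. Approximate scores are $\widehat q_j=F(r_j)-F(k_j)+c_j\in\mathbb R$ and $\pi=\operatorname{softmax}(\widehat q)$, so $0<\pi_j<1$ and $\sum_j\pi_j=1$. Put $g_j=|r_j-k_j|$. Certificate functions. For $b\ge0$ set $d_j(b)=b g_j$, $d(b)=\max_j d_j(b)$, $a_j(b)=b$, $$S_j^{\pm}(b)=\sum_{i\ne j}\pi_i\{\exp[\pm(d_i(b)+d_j(b))]-1\},\quad \ell_j(b)=\frac{\pi_j}{1+S_j^+(b)},\quad u_j(b)=\min\Big\{1,\frac{\pi_j}{1+S_j^-(b)}\Big\},$$ $$B_L(s,b)=\max\{\log(1+S_y^+(b)),-\log(1+S_y^-(b))\},$$ $$B_P(s,b)=\min\Big\{\tanh(d(b)/2),\ \tfrac12\sum_j\max(\pi_j-\ell_j(b),u_j(b)-\pi_j)\Big\},$$ $$B_g(s,b)=\frac{2B_P(s,b)+\sum_{j\ne y}\pi_j a_j(b)+(1-\pi_y)a_y(b)}{\tau}.$$ The denominators $1+S_j^\pm(b)$ are positive. *)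

theory Defs
  imports "HOL-Analysis.Analysis"
begin

text \<open>
  The index type of classes is \<open>'c\<close>, and feature vectors live in \<open>real ^ 'p\<close>.
\<close>

record ('c, 'p) learning_state =
  center :: "'c \<Rightarrow> real ^ 'p"
  coeff :: "'c \<Rightarrow> real"
  offset :: "'c \<Rightarrow> real"
  temp :: real
  feature :: "real ^ 'p"
  target :: 'c

definition valid_state :: "('c::finite, 'p::finite) learning_state \<Rightarrow> bool" where
  "valid_state s \<longleftrightarrow>
     CARD('p) \<ge> 5 \<and> CARD('c) \<ge> 2 \<and>
     (\<forall>j. norm (center s j) = 1) \<and> (\<forall>j. coeff s j \<ge> 0) \<and> temp s > 0"

definition paired_realization :: "(real \<Rightarrow> real) \<Rightarrow> (real \<Rightarrow> real) \<Rightarrow> bool" where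
  "paired_realization F A \<longleftrightarrow>
     (\<forall>r\<ge>0. (F has_real_derivative A r) (at r within {0..})) \<and> A 0 = 0"

definition radius :: "('c::finite, 'p::finite) learning_state \<Rightarrow> 'c \<Rightarrow> real" where
  "radius s j = norm (coeff s j *\<^sub>R center s j + feature s /\<^sub>R temp s)"

definition endpoint_gap :: "('c::finite, 'p::finite) learning_state \<Rightarrow> 'c \<Rightarrow> real" where
  "endpoint_gap s j = \<bar>radius s j - coeff s j\<bar>"

definition approx_score ::
  "(real \<Rightarrow> real) \<Rightarrow> ('c::finite, 'p::finite) learning_state \<Rightarrow> 'c \<Rightarrow> real" where
  "approx_score F s j = F (radius s j) - F (coeff s j) + offset s j"

definition softmax :: "('c::finite \<Rightarrow> real) \<Rightarrow> 'c \<Rightarrow> real" where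
  "softmax q j = exp (q j) / (\<Sum>i\<in>UNIV. exp (q i))"

definition approx_prob ::
  "(real \<Rightarrow> real) \<Rightarrow> ('c::finite, 'p::finite) learning_state \<Rightarrow> 'c \<Rightarrow> real" where
  "approx_prob F s = softmax (approx_score F s)"

text \<open>
  From here on nothing refers to the state itself: the certificates and the acceptance test
  take only the probabilities \<open>\<pi>\<close>, the gaps \<open>g\<close>, the target \<open>y\<close>, the temperature \<open>\<tau>\<close> and the
  scalar allowance \<open>b\<close>, together with the budgets in the case of the acceptance test.
\<close>

definition class_dev :: "('c::finite \<Rightarrow> real) \<Rightarrow> real \<Rightarrow> 'c \<Rightarrow> real" where
  "class_dev g b j = b * g j"

definition max_dev :: "('c::finite \<Rightarrow> real) \<Rightarrow> real \<Rightarrow> real" where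
  "max_dev g b = Max (range (class_dev g b))"

definition slope_dev :: "real \<Rightarrow> 'c \<Rightarrow> real" where
  "slope_dev b j = b"

definition S_plus :: "('c::finite \<Rightarrow> real) \<Rightarrow> ('c \<Rightarrow> real) \<Rightarrow> real \<Rightarrow> 'c \<Rightarrow> real" where
  "S_plus \<pi> g b j = (\<Sum>i\<in>UNIV - {j}. \<pi> i * (exp (class_dev g b i + class_dev g b j) - 1))"

definition S_minus :: "('c::finite \<Rightarrow> real) \<Rightarrow> ('c \<Rightarrow> real) \<Rightarrow> real \<Rightarrow> 'c \<Rightarrow> real" where
  "S_minus \<pi> g b j = (\<Sum>i\<in>UNIV - {j}. \<pi> i * (exp (- (class_dev g b i + class_dev g b j)) - 1))"

definition prob_lower :: "('c::finite \<Rightarrow> real) \<Rightarrow> ('c \<Rightarrow> real) \<Rightarrow> real \<Rightarrow> 'c \<Rightarrow> real" where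
  "prob_lower \<pi> g b j = \<pi> j / (1 + S_plus \<pi> g b j)"

definition prob_upper :: "('c::finite \<Rightarrow> real) \<Rightarrow> ('c \<Rightarrow> real) \<Rightarrow> real \<Rightarrow> 'c \<Rightarrow> real" where
  "prob_upper \<pi> g b j = min 1 (\<pi> j / (1 + S_minus \<pi> g b j))"

definition B_L :: "('c::finite \<Rightarrow> real) \<Rightarrow> ('c \<Rightarrow> real) \<Rightarrow> 'c \<Rightarrow> real \<Rightarrow> real" where
  "B_L \<pi> g y b = max (ln (1 + S_plus \<pi> g b y)) (- ln (1 + S_minus \<pi> g b y))"

definition B_P :: "('c::finite \<Rightarrow> real) \<Rightarrow> ('c \<Rightarrow> real) \<Rightarrow> real \<Rightarrow> real" where
  "B_P \<pi> g b =
     min (tanh (max_dev g b / 2))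
         (1/2 * (\<Sum>j\<in>UNIV. max (\<pi> j - prob_lower \<pi> g b j) (prob_upper \<pi> g b j - \<pi> j)))"

definition B_g :: "('c::finite \<Rightarrow> real) \<Rightarrow> ('c \<Rightarrow> real) \<Rightarrow> 'c \<Rightarrow> real \<Rightarrow> real \<Rightarrow> real" where
  "B_g \<pi> g y \<tau> b =
     (2 * B_P \<pi> g b + (\<Sum>j\<in>UNIV - {y}. \<pi> j * slope_dev b j) + (1 - \<pi> y) * slope_dev b y) / \<tau>"

datatype quantity = Loss | Prob | Grad

fun cert :: "quantity \<Rightarrow> ('c::finite \<Rightarrow> real) \<Rightarrow> ('c \<Rightarrow> real) \<Rightarrow> 'c \<Rightarrow> real \<Rightarrow> real \<Rightarrow> real" where
  "cert Loss \<pi> g y \<tau> b = B_L \<pi> g y b"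
| "cert Prob \<pi> g y \<tau> b = B_P \<pi> g b"
| "cert Grad \<pi> g y \<tau> b = B_g \<pi> g y \<tau> b"

text \<open>The values of \<open>\<epsilon>\<close> outside the selected set \<open>G\<close> play no role.\<close>

definition accepts :: "('c::finite \<Rightarrow> real) \<Rightarrow> ('c \<Rightarrow> real) \<Rightarrow> 'c \<Rightarrow> real \<Rightarrow>
    quantity set \<Rightarrow> (quantity \<Rightarrow> real) \<Rightarrow> real \<Rightarrow> bool" where
  "accepts \<pi> g y \<tau> G \<epsilon> b \<longleftrightarrow> (\<forall>q\<in>G. cert q \<pi> g y \<tau> b \<le> \<epsilon> q)"

definition accepted_set :: "('c::finite \<Rightarrow> real) \<Rightarrow> ('c \<Rightarrow> real) \<Rightarrow> 'c \<Rightarrow> real \<Rightarrow>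
    quantity set \<Rightarrow> (quantity \<Rightarrow> real) \<Rightarrow> real set" where
  "accepted_set \<pi> g y \<tau> G \<epsilon> = {b. b \<ge> 0 \<and> accepts \<pi> g y \<tau> G \<epsilon> b}"

text \<open>
  \<open>bisect P lo hi n\<close> is the bracket reached after \<open>n\<close> bisection steps from \<open>[lo, hi]\<close>; the
  test \<open>P\<close> is the only information used. It is meant to be started with \<open>P lo\<close> and \<open>\<not> P hi\<close>.
\<close>

fun bisect :: "(real \<Rightarrow> bool) \<Rightarrow> real \<Rightarrow> real \<Rightarrow> nat \<Rightarrow> real \<times> real" where
  "bisect P lo hi 0 = (lo, hi)"
| "bisect P lo hi (Suc n) =
     (let m = (lo + hi) / 2 in if P m then bisect P m hi n else bisect P lo m n)"

end

theory Submission
  imports Defs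
begin

text \<open>
  Since the probabilities sum to \<open>1\<close>, the quantity \<open>1 + S\<^sup>\<plusminus>\<^sub>j(b)\<close> is \<open>\<pi>\<^sub>j\<close> plus a nonnegative
  combination of the exponentials \<open>exp (\<plusminus> b (g\<^sub>i + g\<^sub>j))\<close>; positivity of the denominators and
  monotonicity in \<open>b\<close> can be read off from this form. An acceptance test built from monotone
  certificates is downward closed, so bisection keeps the supremum inside its bracket.
\<close>

lemma softmax_pos: "softmax q j > 0"
  unfolding softmax_def by (intro divide_pos_pos sum_pos) auto

lemma sum_softmax: "(\<Sum>j\<in>UNIV. softmax q j) = 1"
proof -
  have "(\<Sum>i\<in>UNIV. exp (q i)) > 0"
    by (intro sum_pos) auto
  then show ?thesis
    by (simp add: softmax_def flip: sum_divide_distrib)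
qed

text \<open>Multiplication by a nonnegative \<open>b\<close> is monotone and so commutes with the
  finite maximum. On \<open>{0..}\<close> the maximal deviation is thus linear in \<open>b\<close>,
  which gives its continuity and monotonicity at once.\<close>

lemma max_dev_eq:
  assumes "b \<ge> 0"
  shows "max_dev g b = b * Max (range g)"
proof -
  have "mono ((*) b)"
    using assms by (intro monoI mult_left_mono)
  then have "b * Max (range g) = Max ((*) b ` range g)"
    by (intro mono_Max_commute) auto
  then show ?thesis
    by (simp add: max_dev_def class_dev_def[abs_def] image_image)
qed

lemma mono_on_max:
  fixes f h :: "real \<Rightarrow> real"
  assumes "mono_on S f" "mono_on S h"
  shows "mono_on S (\<lambda>x. max (f x) (h x))"
  using assms by (intro mono_onI max.mono) (auto dest: mono_onD)

lemma mono_on_min: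
  fixes f h :: "real \<Rightarrow> real"
  assumes "mono_on S f" "mono_on S h"
  shows "mono_on S (\<lambda>x. min (f x) (h x))"
  using assms by (intro mono_onI min.mono) (auto dest: mono_onD)

text \<open>These are the only facts about the learning state that the certificates rely on:
  positive weights of total mass 1 (from softmax) and nonnegative gaps (absolute values).\<close>

locale class_weights =
  fixes \<pi> g :: "'c::finite \<Rightarrow> real"
  assumes prob_pos: "\<And>j. \<pi> j > 0"
    and prob_sum: "(\<Sum>j\<in>UNIV. \<pi> j) = 1"
    and gap_nonneg: "\<And>j. g j \<ge> 0"
begin

text \<open>The subtracted weights add up to \<open>1 - \<pi> j\<close>, which cancels the leading 1
  down to \<open>\<pi> j\<close>. The factor \<open>e\<close> is left arbitrary so that both signs
  of the exponent are covered.\<close>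

lemma one_plus_sum_eq:
  "1 + (\<Sum>i\<in>UNIV - {j}. \<pi> i * (e i - 1)) = \<pi> j + (\<Sum>i\<in>UNIV - {j}. \<pi> i * e i)"
proof -
  have "\<pi> j + (\<Sum>i\<in>UNIV - {j}. \<pi> i) = 1"
    using prob_sum sum.remove[of UNIV j \<pi>] by simp
  then show ?thesis
    by (simp add: right_diff_distrib sum_subtractf)
qed

lemma one_plus_S_plus:
  "1 + S_plus \<pi> g b j = \<pi> j + (\<Sum>i\<in>UNIV - {j}. \<pi> i * exp (b * (g i + g j)))"
  unfolding S_plus_def one_plus_sum_eq by (simp add: class_dev_def distrib_left)

lemma one_plus_S_minus:
  "1 + S_minus \<pi> g b j = \<pi> j + (\<Sum>i\<in>UNIV - {j}. \<pi> i * exp (- (b * (g i + g j))))"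
  unfolding S_minus_def one_plus_sum_eq by (simp add: class_dev_def distrib_left)

lemma one_plus_S_plus_pos: "1 + S_plus \<pi> g b j > 0"
  unfolding one_plus_S_plus using prob_pos less_imp_le[OF prob_pos]
  by (intro add_pos_nonneg sum_nonneg mult_nonneg_nonneg) auto

lemma one_plus_S_minus_pos: "1 + S_minus \<pi> g b j > 0"
  unfolding one_plus_S_minus using prob_pos less_imp_le[OF prob_pos]
  by (intro add_pos_nonneg sum_nonneg mult_nonneg_nonneg) auto

text \<open>Each exponent \<open>b * (g i + g j)\<close> has nonnegative slope in \<open>b\<close>
  and enters with a positive weight.\<close>

lemma S_plus_mono:
  assumes "b \<le> b'"
  shows "S_plus \<pi> g b j \<le> S_plus \<pi> g b' j"
proof -
  have "1 + S_plus \<pi> g b j \<le> 1 + S_plus \<pi> g b' j"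
    unfolding one_plus_S_plus using assms
    by (intro add_left_mono sum_mono mult_left_mono)
      (auto intro!: mult_right_mono add_nonneg_nonneg gap_nonneg less_imp_le[OF prob_pos])
  then show ?thesis by simp
qed

lemma S_minus_antimono:
  assumes "b \<le> b'"
  shows "S_minus \<pi> g b' j \<le> S_minus \<pi> g b j"
proof -
  have "1 + S_minus \<pi> g b' j \<le> 1 + S_minus \<pi> g b j"
    unfolding one_plus_S_minus using assms
    by (intro add_left_mono sum_mono mult_left_mono)
      (auto intro!: mult_right_mono add_nonneg_nonneg gap_nonneg less_imp_le[OF prob_pos])
  then show ?thesis by simp
qed

lemma continuous_on_S_plus [continuous_intros]: "continuous_on X (\<lambda>b. S_plus \<pi> g b j)"
  unfolding S_plus_def class_dev_def by (intro continuous_intros)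

lemma continuous_on_S_minus [continuous_intros]: "continuous_on X (\<lambda>b. S_minus \<pi> g b j)"
  unfolding S_minus_def class_dev_def by (intro continuous_intros)

lemma S_zero [simp]: "S_plus \<pi> g 0 j = 0" "S_minus \<pi> g 0 j = 0"
  by (simp_all add: S_plus_def S_minus_def class_dev_def)

section \<open>The loss certificate\<close>

lemma continuous_on_B_L: "continuous_on X (B_L \<pi> g y)"
  unfolding B_L_def[abs_def]
  using less_imp_neq[OF one_plus_S_plus_pos] less_imp_neq[OF one_plus_S_minus_pos]
  by (intro continuous_intros) metis+

lemma mono_B_L: "mono (B_L \<pi> g y)"
  unfolding B_L_def[abs_def]
\<comment> \<open>Here \<open>mono\<close> is monotonicity on \<open>UNIV\<close>. The second branch
  rises because \<open>S_minus\<close> falls and the minus sign in front of \<open>ln\<close>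
  reverses the order.\<close>
proof (rule mono_on_max)
  show "mono (\<lambda>b. ln (1 + S_plus \<pi> g b y))"
    by (intro monoI) (simp add: one_plus_S_plus_pos S_plus_mono)
  show "mono (\<lambda>b. - ln (1 + S_minus \<pi> g b y))"
    by (intro monoI) (simp add: one_plus_S_minus_pos S_minus_antimono)
qed

lemma B_L_zero: "B_L \<pi> g y 0 = 0"
  by (simp add: B_L_def)

section \<open>The probability certificate\<close>

lemma continuous_on_prob_lower [continuous_intros]:
  "continuous_on X (\<lambda>b. prob_lower \<pi> g b j)"
  unfolding prob_lower_def using less_imp_neq[OF one_plus_S_plus_pos]
  by (intro continuous_intros) metis

lemma continuous_on_prob_upper [continuous_intros]:
  "continuous_on X (\<lambda>b. prob_upper \<pi> g b j)"
  unfolding prob_upper_def using less_imp_neq[OF one_plus_S_minus_pos]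
  by (intro continuous_intros) metis

lemma prob_lower_antimono:
  assumes "b \<le> b'"
  shows "prob_lower \<pi> g b' j \<le> prob_lower \<pi> g b j"
  unfolding prob_lower_def using assms
  by (intro divide_left_mono add_left_mono S_plus_mono mult_pos_pos one_plus_S_plus_pos
      less_imp_le[OF prob_pos])

lemma prob_upper_mono:
  assumes "b \<le> b'"
  shows "prob_upper \<pi> g b j \<le> prob_upper \<pi> g b' j"
  unfolding prob_upper_def using assms
  by (intro min.mono order_refl divide_left_mono add_left_mono S_minus_antimono mult_pos_pos
      one_plus_S_minus_pos less_imp_le[OF prob_pos])

lemma continuous_on_B_P: "continuous_on {0..} (B_P \<pi> g)"
proof -
  have "continuous_on {0..} (max_dev g) \<longleftrightarrow> continuous_on {0..} (\<lambda>b. b * Max (range g))"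
    by (intro continuous_on_cong) (auto simp: max_dev_eq)
  then have "continuous_on {0..} (max_dev g)"
    by (simp add: continuous_intros)
  then show ?thesis
    unfolding B_P_def[abs_def]
    \<comment> \<open>Continuity of \<open>tanh\<close> leaves the side condition that
      \<open>cosh\<close> does not vanish.\<close>
    by (intro continuous_intros) (auto simp: less_imp_neq[OF cosh_real_pos, symmetric])
qed

lemma mono_on_B_P: "mono_on {0..} (B_P \<pi> g)"
  unfolding B_P_def[abs_def]
proof (rule mono_on_min)
  \<comment> \<open>The slope of the linear form of \<open>max_dev\<close> must be nonnegative for
    the argument of \<open>tanh\<close> to be nondecreasing.\<close>
  have "Max (range g) \<ge> 0"
    using gap_nonneg by (meson Max_ge finite finite_imageI order_trans rangeI)
  then show "mono_on {0..} (\<lambda>b. tanh (max_dev g b / 2))"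
    by (auto intro!: mono_onI mult_right_mono simp: max_dev_eq)
  show "mono_on {0..} (\<lambda>b. 1/2 * (\<Sum>j\<in>UNIV.
      max (\<pi> j - prob_lower \<pi> g b j) (prob_upper \<pi> g b j - \<pi> j)))"
    by (intro mono_onI mult_left_mono sum_mono max.mono diff_left_mono diff_right_mono
        prob_lower_antimono prob_upper_mono) auto
qed

lemma B_P_zero: "B_P \<pi> g 0 = 0"
proof -
  \<comment> \<open>This makes the cap \<open>min 1\<close> in \<open>prob_upper\<close> inactive at
    \<open>b = 0\<close>.\<close>
  have "\<pi> j \<le> 1" for j
    using prob_sum member_le_sum[of j UNIV \<pi>] less_imp_le[OF prob_pos] by simp
  then have "prob_upper \<pi> g 0 j = \<pi> j" "prob_lower \<pi> g 0 j = \<pi> j" for j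
    by (simp_all add: prob_upper_def prob_lower_def)
  then show ?thesis
    by (simp add: B_P_def max_dev_eq)
qed

section \<open>The gradient certificate\<close>

lemma continuous_on_B_g: "continuous_on {0..} (B_g \<pi> g y \<tau>)"
  unfolding B_g_def[abs_def] slope_dev_def divide_inverse
  by (intro continuous_intros continuous_on_B_P)

lemma mono_on_B_g:
  assumes "\<tau> > 0"
  shows "mono_on {0..} (B_g \<pi> g y \<tau>)"
proof (rule mono_onI)
  fix b b' :: real assume b: "b \<in> {0..}" "b' \<in> {0..}" "b \<le> b'"
  \<comment> \<open>Hence the coefficient \<open>1 - \<pi> y\<close> of the target slope is
    nonnegative.\<close>
  have "\<pi> y \<le> 1"
    using prob_sum member_le_sum[of y UNIV \<pi>] less_imp_le[OF prob_pos] by simp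
  then show "B_g \<pi> g y \<tau> b \<le> B_g \<pi> g y \<tau> b'"
    unfolding B_g_def slope_dev_def using b assms mono_onD[OF mono_on_B_P b]
    by (intro divide_right_mono add_mono mult_left_mono sum_mono less_imp_le[OF prob_pos]) auto
qed

lemma B_g_zero: "B_g \<pi> g y \<tau> 0 = 0"
  by (simp add: B_g_def slope_dev_def B_P_zero)

section \<open>The acceptance test\<close>

lemma mono_on_cert:
  assumes "\<tau> > 0"
  shows "mono_on {0..} (cert q \<pi> g y \<tau>)"
proof (cases q)
  case Loss
  then show ?thesis
    using mono_on_subset[OF mono_B_L subset_UNIV] by (auto simp: mono_on_def)
next
  case Prob
  then show ?thesis
    using mono_on_B_P by (auto simp: mono_on_def)
next
  case Grad
  then show ?thesis
    using mono_on_B_g[OF assms] by (auto simp: mono_on_def)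
qed

lemma cert_zero: "cert q \<pi> g y \<tau> 0 = 0"
  by (cases q) (simp_all add: B_L_zero B_P_zero B_g_zero)

text \<open>Acceptance is a conjunction of upper bounds on nondecreasing functions, so it passes to
  smaller nonnegative allowances.\<close>

lemma accepts_antimono:
  assumes "\<tau> > 0" "0 \<le> a" "a \<le> b" "accepts \<pi> g y \<tau> G \<epsilon> b"
  shows "accepts \<pi> g y \<tau> G \<epsilon> a"
proof -
  have "cert q \<pi> g y \<tau> a \<le> cert q \<pi> g y \<tau> b" for q
    using assms by (intro mono_onD[OF mono_on_cert]) auto
  then show ?thesis
    using assms(4) unfolding accepts_def by (meson order_trans)
qed

lemma accepts_zero:
  assumes "\<And>q. q \<in> G \<Longrightarrow> \<epsilon> q > 0"
  shows "accepts \<pi> g y \<tau> G \<epsilon> 0"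
  using assms by (auto simp: accepts_def cert_zero intro: less_imp_le)

end

section \<open>Bisection towards the supremum of a downward closed test\<close>

lemma bisect_bracket:
  assumes "P lo" "\<not> P hi" "lo \<ge> 0" "hi \<ge> 0"
  shows "P (fst (bisect P lo hi n))" "\<not> P (snd (bisect P lo hi n))"
    "fst (bisect P lo hi n) \<ge> 0" "snd (bisect P lo hi n) \<ge> 0"
    "snd (bisect P lo hi n) - fst (bisect P lo hi n) = (hi - lo) / 2 ^ n"
  using assms
proof (induction n arbitrary: lo hi)
  case (Suc n)
  { case 1 with Suc.IH(1) show ?case by (simp add: Let_def)
  next case 2 with Suc.IH(2) show ?case by (simp add: Let_def)
  next case 3 with Suc.IH(3) show ?case by (simp add: Let_def)
  next case 4 with Suc.IH(4) show ?case by (simp add: Let_def)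
  next
    case 5
    \<comment> \<open>Both halves have the same length, so the width halves whichever way the test
      at the midpoint turns out.\<close>
    have "(hi + lo) / 2 - lo = (hi - lo) / 2" "hi - (hi + lo) / 2 = (hi - lo) / 2"
      by (simp_all add: field_simps)
    with 5 Suc.IH(5)[of "(hi + lo) / 2" hi] Suc.IH(5)[of lo "(hi + lo) / 2"] show ?case
      by (simp add: Let_def add.commute)
  }
qed simp_all

locale bounded_threshold =
  fixes P :: "real \<Rightarrow> bool"
  assumes down_closed: "\<And>a b. 0 \<le> a \<Longrightarrow> a \<le> b \<Longrightarrow> P b \<Longrightarrow> P a"
    and bdd: "bdd_above {b. b \<ge> 0 \<and> P b}"
begin

text \<open>Powers of two eventually exceed any bound on the accepted values, so doubling finds a
  rejected right end from which bisection can start.\<close>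

lemma power_rejected: "\<exists>n::nat. \<not> P (2 ^ n)"
proof -
  obtain M where M: "\<And>b. b \<ge> 0 \<Longrightarrow> P b \<Longrightarrow> b \<le> M"
    using bdd by (auto simp: bdd_above_def)
  obtain n where "M < 2 ^ n"
    using real_arch_pow[of 2 M] by auto
  then show ?thesis
    using M[of "2 ^ n"] by (intro exI[of _ n]) auto
qed

text \<open>The point \<open>l\<close> lies in the accepted set. The rejected point \<open>h\<close>
  bounds it from above, since an accepted value beyond \<open>h\<close> would force
  \<open>P h\<close> by downward closure.\<close>

lemma Sup_bracket:
  assumes "P l" "\<not> P h" "0 \<le> l" "0 \<le> h"
  shows "l \<le> Sup {b. b \<ge> 0 \<and> P b}" "Sup {b. b \<ge> 0 \<and> P b} \<le> h"
proof -
  show "l \<le> Sup {b. b \<ge> 0 \<and> P b}"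
    using assms bdd by (intro cSup_upper) auto
  show "Sup {b. b \<ge> 0 \<and> P b} \<le> h"
  proof (rule cSup_least)
    show "{b. b \<ge> 0 \<and> P b} \<noteq> {}"
      using assms by auto
    show "b \<le> h" if "b \<in> {b. b \<ge> 0 \<and> P b}" for b
      using that assms down_closed[of h b] by force
  qed
qed

lemma bisect_tendsto_Sup:
  assumes "P lo" "\<not> P hi" "lo \<ge> 0" "hi \<ge> 0"
  shows "(\<lambda>n. fst (bisect P lo hi n)) \<longlonglongrightarrow> Sup {b. b \<ge> 0 \<and> P b}" (is "?l \<longlonglongrightarrow> ?s")
    and "(\<lambda>n. snd (bisect P lo hi n)) \<longlonglongrightarrow> Sup {b. b \<ge> 0 \<and> P b}" (is "?h \<longlonglongrightarrow> _")
proof -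
  note br = bisect_bracket[of P lo hi, OF assms]
  have bounds: "?l n \<le> ?s" "?s \<le> ?h n" for n
    using Sup_bracket[OF br(1-4)] by auto
  have width: "(\<lambda>n. (hi - lo) / 2 ^ n) \<longlonglongrightarrow> 0"
    using LIMSEQ_divide_realpow_zero[of 2 "hi - lo"] by simp
  \<comment> \<open>The distance from the left end to the supremum lies between 0 and the bracket
    width, which tends to 0.\<close>
  have "(\<lambda>n. ?s - ?l n) \<longlonglongrightarrow> 0"
  proof (rule tendsto_sandwich[OF _ _ tendsto_const width]; intro always_eventually allI)
    show "0 \<le> ?s - ?l n" "?s - ?l n \<le> (hi - lo) / 2 ^ n" for n
      using bounds[of n] br(5)[of n] by linarith+
  qed
  from tendsto_diff[OF tendsto_const[of ?s] this] show lower: "?l \<longlonglongrightarrow> ?s"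
    by simp
  \<comment> \<open>The right end differs from the left one by the vanishing width, so it has the
    same limit.\<close>
  have "?h = (\<lambda>n. ?l n + (hi - lo) / 2 ^ n)"
    using br(5) by (simp add: fun_eq_iff algebra_simps)
  with tendsto_add[OF lower width] show "?h \<longlonglongrightarrow> ?s"
    by simp
qed

end

text \<open>A finite supremum is expressed by \<open>bdd_above\<close>, as the accepted set contains
  0. That point can serve as \<open>lo\<close>, and a rejected power of two as \<open>hi\<close>.
  That no exact quantity is used is visible in the arguments of \<open>accepts\<close>, the only
  information passed to \<open>bisect\<close>.\<close>

theorem proposition4:
  fixes s :: "('c::finite, 'p::finite) learning_state"
    and F A :: "real \<Rightarrow> real"
    and \<pi> g :: "'c \<Rightarrow> real" and y :: 'c and \<tau> :: real
  assumes "valid_state s"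
    and "paired_realization F A"
    and "\<pi> = approx_prob F s"
    and "g = endpoint_gap s"
    and "y = target s"
    and "\<tau> = temp s"
  shows "(continuous_on {0..} (B_L \<pi> g y) \<and> mono_on {0..} (B_L \<pi> g y) \<and> B_L \<pi> g y 0 = 0) \<and>
    (continuous_on {0..} (B_P \<pi> g) \<and> mono_on {0..} (B_P \<pi> g) \<and> B_P \<pi> g 0 = 0) \<and>
    (continuous_on {0..} (B_g \<pi> g y \<tau>) \<and> mono_on {0..} (B_g \<pi> g y \<tau>) \<and> B_g \<pi> g y \<tau> 0 = 0) \<and>
    (\<forall>G \<epsilon>. (\<forall>q\<in>G. \<epsilon> q > 0) \<longrightarrow>
       is_interval (accepted_set \<pi> g y \<tau> G \<epsilon>) \<and>
       0 \<in> accepted_set \<pi> g y \<tau> G \<epsilon> \<and>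
       accepted_set \<pi> g y \<tau> G \<epsilon> \<subseteq> {0..} \<and>
       (bdd_above (accepted_set \<pi> g y \<tau> G \<epsilon>) \<longrightarrow>
          (\<exists>n::nat. \<not> accepts \<pi> g y \<tau> G \<epsilon> (2 ^ n)) \<and>
          (\<forall>lo hi. lo \<ge> 0 \<and> hi \<ge> 0 \<and> accepts \<pi> g y \<tau> G \<epsilon> lo \<and> \<not> accepts \<pi> g y \<tau> G \<epsilon> hi \<longrightarrow>
             (\<forall>n. fst (bisect (accepts \<pi> g y \<tau> G \<epsilon>) lo hi n) \<le> Sup (accepted_set \<pi> g y \<tau> G \<epsilon>) \<and>
                  Sup (accepted_set \<pi> g y \<tau> G \<epsilon>) \<le> snd (bisect (accepts \<pi> g y \<tau> G \<epsilon>) lo hi n) \<and>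
                  snd (bisect (accepts \<pi> g y \<tau> G \<epsilon>) lo hi n)
                    - fst (bisect (accepts \<pi> g y \<tau> G \<epsilon>) lo hi n) = (hi - lo) / 2 ^ n) \<and>
             (\<lambda>n. fst (bisect (accepts \<pi> g y \<tau> G \<epsilon>) lo hi n))
               \<longlonglongrightarrow> Sup (accepted_set \<pi> g y \<tau> G \<epsilon>) \<and>
             (\<lambda>n. snd (bisect (accepts \<pi> g y \<tau> G \<epsilon>) lo hi n))
               \<longlonglongrightarrow> Sup (accepted_set \<pi> g y \<tau> G \<epsilon>))))"
proof -
  have pos: "\<pi> j > 0" for j
    using assms(3) by (simp add: approx_prob_def softmax_pos)
  have sum: "(\<Sum>j\<in>UNIV. \<pi> j) = 1"
    using assms(3) by (simp add: approx_prob_def sum_softmax)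
  have gap: "g j \<ge> 0" for j
    using assms(4) by (simp add: endpoint_gap_def)
  have \<tau>: "\<tau> > 0"
    using assms(1,6) by (simp add: valid_state_def)
  interpret class_weights \<pi> g
    by unfold_locales (fact pos sum gap)+
  have set: "accepted_set \<pi> g y \<tau> G \<epsilon> = {b. b \<ge> 0 \<and> accepts \<pi> g y \<tau> G \<epsilon> b}" for G \<epsilon>
    by (simp add: accepted_set_def)
  note down = accepts_antimono[OF \<tau>]
  have interval: "is_interval (accepted_set \<pi> g y \<tau> G \<epsilon>)" for G \<epsilon>
    \<comment> \<open>A point between two accepted ones is at least the smaller, hence nonnegative,
      and at most the larger, hence accepted.\<close>
    unfolding is_interval_1 set using down by force
  have zero: "0 \<in> accepted_set \<pi> g y \<tau> G \<epsilon>" if "\<forall>q\<in>G. \<epsilon> q > 0" for G \<epsilon>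
    unfolding set using accepts_zero that by simp
  show ?thesis
  proof (intro conjI allI impI; (elim conjE)?)
    show "continuous_on {0..} (B_L \<pi> g y)" "mono_on {0..} (B_L \<pi> g y)" "B_L \<pi> g y 0 = 0"
      using continuous_on_B_L mono_on_subset[OF mono_B_L subset_UNIV]
        B_L_zero by blast+
    show "continuous_on {0..} (B_P \<pi> g)" "mono_on {0..} (B_P \<pi> g)" "B_P \<pi> g 0 = 0"
      using continuous_on_B_P mono_on_B_P B_P_zero by blast+
    show "continuous_on {0..} (B_g \<pi> g y \<tau>)" "mono_on {0..} (B_g \<pi> g y \<tau>)"
      "B_g \<pi> g y \<tau> 0 = 0"
      using continuous_on_B_g mono_on_B_g[OF \<tau>] B_g_zero by blast+
  next
    fix G :: "quantity set" and \<epsilon> :: "quantity \<Rightarrow> real"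
    assume "\<forall>q\<in>G. \<epsilon> q > 0"
    then show "is_interval (accepted_set \<pi> g y \<tau> G \<epsilon>)" "0 \<in> accepted_set \<pi> g y \<tau> G \<epsilon>"
      using interval zero by blast+
    show "accepted_set \<pi> g y \<tau> G \<epsilon> \<subseteq> {0..}"
      by (auto simp: set)
  next
    fix G \<epsilon> assume bdd: "bdd_above (accepted_set \<pi> g y \<tau> G \<epsilon>)"
    interpret bounded_threshold "accepts \<pi> g y \<tau> G \<epsilon>"
      by unfold_locales (fact down, fact bdd[unfolded set])
    show "\<exists>n::nat. \<not> accepts \<pi> g y \<tau> G \<epsilon> (2 ^ n)"
      by (rule power_rejected)
  next
    fix G \<epsilon> and lo hi :: real
    let ?P = "accepts \<pi> g y \<tau> G \<epsilon>"
    assume bdd: "bdd_above (accepted_set \<pi> g y \<tau> G \<epsilon>)"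
      and start: "0 \<le> lo" "0 \<le> hi" "?P lo" "\<not> ?P hi"
    interpret bounded_threshold ?P
      by unfold_locales (fact down, fact bdd[unfolded set])
    note br = bisect_bracket[of ?P lo hi, OF start(3,4,1,2)]
    show "fst (bisect ?P lo hi n) \<le> Sup (accepted_set \<pi> g y \<tau> G \<epsilon>)"
      "Sup (accepted_set \<pi> g y \<tau> G \<epsilon>) \<le> snd (bisect ?P lo hi n)" for n
      unfolding set using Sup_bracket[OF br(1-4)] by blast+
    show "snd (bisect ?P lo hi n) - fst (bisect ?P lo hi n) = (hi - lo) / 2 ^ n" for n
      by (rule br(5))
    show "(\<lambda>n. fst (bisect ?P lo hi n)) \<longlonglongrightarrow> Sup (accepted_set \<pi> g y \<tau> G \<epsilon>)"
      "(\<lambda>n. snd (bisect ?P lo hi n)) \<longlonglongrightarrow> Sup (accepted_set \<pi> g y \<tau> G \<epsilon>)"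
      unfolding set
      using bisect_tendsto_Sup[OF start(3,4,1,2)] by blast+
  qed
qed

end
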